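(* Let $\epsilon\in\{1,-1\}$ and $\boldsymbol A\cdot\boldsymbol B=A_0B_0+\epsilon(A_1B_1+A_2B_2)$ on $\mathbb R^3$. Let $F:\mathbb Z^2\to\mathbb R$, let $\boldsymbol N:\mathbb Z^2\to\mathbb R^3$ satisfy the discrete Moutard equation $\boldsymbol N_{(12)}+\boldsymbol N=F(\boldsymbol N_{(1)}+\boldsymbol N_{(2)})$, and let $\Theta:\mathbb Z^2\to\mathbb R$ be a nowhere zero scalar solution of the same equation, $\Theta_{(12)}+\Theta=F(\Theta_{(1)}+\Theta_{(2)})$. Fix a choice of sign (all upper or all lower), and let $\boldsymbol N':\mathbb Z^2\to\mathbb R^3$ be connected with $\boldsymbol N$ by the discrete Moutard transformation $$\boldsymbol N'_{(1)}\mp\boldsymbol N=\frac{\Theta}{\Theta_{(1)}}(\boldsymbol N'\mp\boldsymbol N_{(1)}),\qquad \boldsymbol N'_{(2)}\pm\boldsymbol N=\frac{\Theta}{\Theta_{(2)}}(\boldsymbol N'\pm\boldsymbol N_{(2)}).$$ Then the condition $$(\boldsymbol N_{(12)}+\boldsymbol N)\cdot(\boldsymbol N_{(1)}+\boldsymbol N_{(2)})=(\boldsymbol N'_{(12)}+\boldsymbol N')\cdot(\boldsymbol N'_{(1)}+\boldsymbol N'_{(2)})$$ is equivalent to the following system of three equations: $$(\boldsymbol N_{(12)}+\boldsymbol N)\cdot(\boldsymbol N_{(1)}+\boldsymbol N_{(2)})=U(m_1)+V(m_2),$$ $$(\boldsymbol N'_{(1)}\mp\boldsymbol N)\cdot(\boldsymbol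 N'\mp\boldsymbol N_{(1)})=U(m_1)\mp k,$$ $$(\boldsymbol N'_{(2)}\pm\boldsymbol N)\cdot(\boldsymbol N'\pm\boldsymbol N_{(2)})=V(m_2)\pm k,$$ where $U(m_1)$ and $V(m_2)$ are (some) functions of single variables only and $k$ is a (some) constant.
   Context: For a function $g$ on $\mathbb Z^2$, subscripts in brackets denote shifts in the discrete variables $(m_1,m_2)\in\mathbb Z^2$: $g_{(1)}(m_1,m_2)=g(m_1+1,m_2)$, $g_{(2)}(m_1,m_2)=g(m_1,m_2+1)$, $g_{(12)}(m_1,m_2)=g(m_1+1,m_2+1)$. In $\pm,\mp$ one takes either all upper signs or all lower signs. All equations are understood to hold at every point of $\mathbb Z^2$.
   Formalization: The implication from the condition to the three-equation system is proved under the added assumption that Θ_(12)+Θ vanishes nowhere; without it the claim fails (e.g. N=0, F=0, Θ=2^{m_1}(-1/2)^{m_2}, N'=e_0/Θ). The converse is proved without it. *)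

theory Defs
  imports "HOL-Analysis.Analysis"
begin

text \<open>
  Lattice functions on \<open>\<int>\<^sup>2\<close> are curried, \<open>g m1 m2\<close>, so that \<open>g\<^sub>(\<^sub>1\<^sub>)\<close>, \<open>g\<^sub>(\<^sub>2\<^sub>)\<close>, \<open>g\<^sub>(\<^sub>1\<^sub>2\<^sub>)\<close>
  are \<open>g (m1 + 1) m2\<close>, \<open>g m1 (m2 + 1)\<close>, \<open>g (m1 + 1) (m2 + 1)\<close>.
\<close>

text \<open>In the index type \<^typ>\<open>3\<close> the numerals 0, 1, 2 are the three distinct elements (\<open>0 = 3\<close>).\<close>

definition eps_dot :: "real \<Rightarrow> real^3 \<Rightarrow> real^3 \<Rightarrow> real" where
  "eps_dot \<epsilon> A B = A $ 0 * B $ 0 + \<epsilon> * (A $ 1 * B $ 1 + A $ 2 * B $ 2)"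

text \<open>Used both for vector-valued and, with \<open>*\<^sub>R\<close> being real multiplication, for scalar solutions.\<close>

definition discrete_moutard :: "(int \<Rightarrow> int \<Rightarrow> real) \<Rightarrow> (int \<Rightarrow> int \<Rightarrow> 'a::real_vector) \<Rightarrow> bool" where
  "discrete_moutard F g \<longleftrightarrow>
     (\<forall>m1 m2. g (m1 + 1) (m2 + 1) + g m1 m2 = F m1 m2 *\<^sub>R (g (m1 + 1) m2 + g m1 (m2 + 1)))"

text \<open>
  Throughout, \<open>s = 1\<close> selects the upper and \<open>s = - 1\<close> the lower signs:
  \<open>\<plusminus>\<close> becomes \<open>+ s\<close> and \<open>\<mp>\<close> becomes \<open>- s\<close>.
\<close>

definition moutard_transform ::
    "real \<Rightarrow> (int \<Rightarrow> int \<Rightarrow> real) \<Rightarrow> (int \<Rightarrow> int \<Rightarrow> real^3) \<Rightarrow> (int \<Rightarrow> int \<Rightarrow> real^3) \<Rightarrow> bool" where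
  "moutard_transform s \<Theta> N N' \<longleftrightarrow>
     (\<forall>m1 m2.
        N' (m1 + 1) m2 - s *\<^sub>R N m1 m2
          = (\<Theta> m1 m2 / \<Theta> (m1 + 1) m2) *\<^sub>R (N' m1 m2 - s *\<^sub>R N (m1 + 1) m2) \<and>
        N' m1 (m2 + 1) + s *\<^sub>R N m1 m2
          = (\<Theta> m1 m2 / \<Theta> m1 (m2 + 1)) *\<^sub>R (N' m1 m2 + s *\<^sub>R N m1 (m2 + 1)))"

definition diagonal_product ::
    "real \<Rightarrow> (int \<Rightarrow> int \<Rightarrow> real^3) \<Rightarrow> int \<Rightarrow> int \<Rightarrow> real" where
  "diagonal_product \<epsilon> N m1 m2 =
     eps_dot \<epsilon> (N (m1 + 1) (m2 + 1) + N m1 m2) (N (m1 + 1) m2 + N m1 (m2 + 1))"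

definition separated_system ::
    "real \<Rightarrow> real \<Rightarrow> (int \<Rightarrow> int \<Rightarrow> real^3) \<Rightarrow> (int \<Rightarrow> int \<Rightarrow> real^3)
      \<Rightarrow> (int \<Rightarrow> real) \<Rightarrow> (int \<Rightarrow> real) \<Rightarrow> real \<Rightarrow> bool" where
  "separated_system \<epsilon> s N N' U V k \<longleftrightarrow>
     (\<forall>m1 m2.
        diagonal_product \<epsilon> N m1 m2 = U m1 + V m2 \<and>
        eps_dot \<epsilon> (N' (m1 + 1) m2 - s *\<^sub>R N m1 m2) (N' m1 m2 - s *\<^sub>R N (m1 + 1) m2) = U m1 - s * k \<and>
        eps_dot \<epsilon> (N' m1 (m2 + 1) + s *\<^sub>R N m1 m2) (N' m1 m2 + s *\<^sub>R N m1 (m2 + 1)) = V m2 + s * k)"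

end

theory Submission
  imports Defs
begin

text \<open>
  Write \<open>A\<close> and \<open>B\<close> for the left-hand sides of the last two equations of the system, and \<open>D\<close>, \<open>D'\<close>
  for the diagonal products of \<open>N\<close>, \<open>N'\<close>. Expanding the products gives, for arbitrary lattice
  functions, \<open>A + A\<^sub>(\<^sub>2\<^sub>) + B + B\<^sub>(\<^sub>1\<^sub>) = D + D'\<close>. The Moutard transformation gives moreover
  \<open>(A\<^sub>(\<^sub>2\<^sub>) - A) (\<Theta>\<^sub>(\<^sub>1\<^sub>2\<^sub>) + \<Theta>) = (D' - D) (\<Theta> - F \<Theta>\<^sub>(\<^sub>2\<^sub>))\<close> and the same with the two directions exchanged.
  Hence \<open>D = D'\<close> forces \<open>A = A\<^sub>(\<^sub>2\<^sub>)\<close>, \<open>B = B\<^sub>(\<^sub>1\<^sub>)\<close> and \<open>D = A + B\<close>, so \<open>U = A\<close>, \<open>V = B\<close>, \<open>k = 0\<close>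
  solve the system; conversely the system gives \<open>D + D' = 2 (A + B) = 2 D\<close>.
\<close>

text \<open>In each coordinate the terms linear in \<open>s\<close> cancel between edges of
  different direction, and \<open>s\<^sup>2 = 1\<close> frees the products of \<open>n\<close>-terms
  from signs.\<close>

lemma eps_dot_sum_around_square:
  fixes n n1 n2 n12 p p1 p2 p12 :: "real^3"
  assumes "s\<^sup>2 = 1"
  shows "eps_dot \<epsilon> (p1 - s *\<^sub>R n) (p - s *\<^sub>R n1) + eps_dot \<epsilon> (p12 - s *\<^sub>R n2) (p2 - s *\<^sub>R n12)
       + eps_dot \<epsilon> (p2 + s *\<^sub>R n) (p + s *\<^sub>R n2) + eps_dot \<epsilon> (p12 + s *\<^sub>R n1) (p1 + s *\<^sub>R n12)
       = eps_dot \<epsilon> (n12 + n) (n1 + n2) + eps_dot \<epsilon> (p12 + p) (p1 + p2)"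
proof -
  have *: "(p1 - s * n) * (p - s * n1) + (p12 - s * n2) * (p2 - s * n12)
       + (p2 + s * n) * (p + s * n2) + (p12 + s * n1) * (p1 + s * n12)
       = (n12 + n) * (n1 + n2) + (p12 + p) * (p1 + p2)" for n n1 n2 n12 p p1 p2 p12
    using assms by algebra
  show ?thesis
    using *[of "p1$0" "n$0" "p$0" "n1$0" "p12$0" "n2$0" "p2$0" "n12$0"]
      *[of "p1$1" "n$1" "p$1" "n1$1" "p12$1" "n2$1" "p2$1" "n12$1"]
      *[of "p1$2" "n$2" "p$2" "n1$2" "p12$2" "n2$2" "p2$2" "n12$2"]
    unfolding eps_dot_def vector_add_component vector_minus_component vector_scaleR_component
      real_scaleR_def
    by algebra
qed

text \<open>This is the case of a single coordinate. Once denominators are cleared, every product is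
  a quadratic form in \<open>x\<close> and \<open>y\<close>, which leaves a polynomial
  identity.\<close>

lemma moutard_square_increment_real:
  fixes n n1 n2 n12 p p1 p2 p12 t t1 t2 t12 F s :: real
  assumes s: "s\<^sup>2 = 1" and nz: "t1 \<noteq> 0" "t2 \<noteq> 0" "t12 \<noteq> 0"
    and n: "n12 + n = F * (n1 + n2)" and t: "t12 + t = F * (t1 + t2)"
    and p1: "p1 - s * n = t / t1 * (p - s * n1)"
    and p2: "p2 + s * n = t / t2 * (p + s * n2)"
    and p12: "p12 - s * n2 = t2 / t12 * (p2 - s * n12)"
  shows "((p12 - s * n2) * (p2 - s * n12) - (p1 - s * n) * (p - s * n1)) * (t12 + t)
       = ((p12 + p) * (p1 + p2) - (n12 + n) * (n1 + n2)) * (t - F * t2)"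
proof -
  define x y z where "x = p - s * n1" and "y = p + s * n2" and "z = p2 - s * n12"
  note xyz = x_def y_def z_def
  \<comment> \<open>Here \<open>z\<close> is \<open>p2 + s * n\<close> minus
    \<open>s * (n12 + n)\<close>, and \<open>y - x = s * (n1 + n2)\<close>.\<close>
  have z: "t2 * z = t * y - F * t2 * (y - x)"
  proof -
    have "t2 * (p2 + s * n) = t * y" using p2 nz by (simp add: y_def)
    moreover have "s * (n12 + n) = F * (y - x)" using n by (simp add: xyz algebra_simps)
    ultimately show ?thesis unfolding z_def by algebra
  qed
  have 12: "t12 * (p12 + p) = F * (t2 * x + t1 * y)"
  proof -
    have "t12 * (p12 - s * n2) = t2 * z" using p12 nz by (simp add: z_def)
    \<comment> \<open>Split \<open>p12 + p\<close> as \<open>(p12 - s * n2) + y\<close>.\<close>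
    then have "t12 * (p12 + p) = t2 * z + t12 * y" unfolding xyz by algebra
    then show ?thesis using z t by algebra
  qed
  have 1: "t1 * t2 * (p1 + p2) = t * (t2 * x + t1 * y)"
  proof -
    have "t1 * (p1 - s * n) = t * x" "t2 * (p2 + s * n) = t * y"
      using p1 p2 nz by (simp_all add: xyz)
    then show ?thesis by algebra
  qed
  have N: "(n12 + n) * (n1 + n2) = F * (y - x)\<^sup>2"
    using n s unfolding xyz by algebra
  have A: "t1 * ((p1 - s * n) * (p - s * n1)) = t * x\<^sup>2"
    using p1 nz by (simp add: x_def power2_eq_square)
  have A2: "t2 * t12 * ((p12 - s * n2) * (p2 - s * n12)) = (t2 * z)\<^sup>2"
    using p12 nz by (simp add: z_def power2_eq_square)
  have "t1 * t2 * t12 * (((p12 - s * n2) * (p2 - s * n12) - (p1 - s * n) * (p - s * n1)) * (t12 + t))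
      = (t1 * (t * y - F * t2 * (y - x))\<^sup>2 - t2 * t12 * t * x\<^sup>2) * (t12 + t)"
    using A A2[unfolded z] by algebra
  also have "\<dots> = (F * t * (t2 * x + t1 * y)\<^sup>2 - t1 * t2 * t12 * F * (y - x)\<^sup>2) * (t - F * t2)"
  proof -
    \<comment> \<open>Eliminating \<open>t12\<close> turns the claim into an identity of polynomials
      in \<open>F\<close>, \<open>t\<close>, \<open>t1\<close>, \<open>t2\<close>, \<open>x\<close>,
      \<open>y\<close>.\<close>
    have "t12 = F * (t1 + t2) - t" using t by simp
    then show ?thesis by algebra
  qed
  also have "\<dots> = t1 * t2 * t12 * (((p12 + p) * (p1 + p2) - (n12 + n) * (n1 + n2)) * (t - F * t2))"
  proof -
    have "F * t * (t2 * x + t1 * y)\<^sup>2 = t1 * t2 * t12 * ((p12 + p) * (p1 + p2))"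
      using 12 1 by algebra
    then show ?thesis unfolding N by algebra
  qed
  finally show ?thesis using nz by simp
qed

text \<open>The scalar factors are the same in all coordinates, so the one-coordinate identities add
  up with the weights 1, \<open>\<epsilon>\<close>, \<open>\<epsilon>\<close>.\<close>

lemma moutard_square_increment:
  fixes n n1 n2 n12 p p1 p2 p12 :: "real^3"
  assumes "s\<^sup>2 = 1" and "t1 \<noteq> 0" "t2 \<noteq> 0" "t12 \<noteq> 0"
    and "n12 + n = F *\<^sub>R (n1 + n2)" and "t12 + t = F * (t1 + t2)"
    and "p1 - s *\<^sub>R n = (t / t1) *\<^sub>R (p - s *\<^sub>R n1)"
    and "p2 + s *\<^sub>R n = (t / t2) *\<^sub>R (p + s *\<^sub>R n2)"
    and "p12 - s *\<^sub>R n2 = (t2 / t12) *\<^sub>R (p2 - s *\<^sub>R n12)"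
  shows "(eps_dot \<epsilon> (p12 - s *\<^sub>R n2) (p2 - s *\<^sub>R n12) - eps_dot \<epsilon> (p1 - s *\<^sub>R n) (p - s *\<^sub>R n1)) * (t12 + t)
       = (eps_dot \<epsilon> (p12 + p) (p1 + p2) - eps_dot \<epsilon> (n12 + n) (n1 + n2)) * (t - F * t2)"
proof -
  have *: "((p12$i - s * n2$i) * (p2$i - s * n12$i) - (p1$i - s * n$i) * (p$i - s * n1$i)) * (t12 + t)
       = ((p12$i + p$i) * (p1$i + p2$i) - (n12$i + n$i) * (n1$i + n2$i)) * (t - F * t2)" for i
    using assms
    by (intro moutard_square_increment_real[where ?t1.0 = t1]) (simp_all add: vec_eq_iff)
  show ?thesis
    using *[of 0] *[of 1] *[of 2]
    unfolding eps_dot_def vector_add_component vector_minus_component vector_scaleR_component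
      real_scaleR_def
    by algebra
qed

lemma int_shift_invariant_imp_const:
  fixes f :: "int \<Rightarrow> 'a"
  assumes "\<And>m. f (m + 1) = f m"
  shows "f m = f 0"
proof (induction m rule: int_induct[where k = 0])
  case (step2 i)
  then show ?case using assms[of "i - 1"] by simp
qed (simp_all add: assms)

theorem theorem4:
  fixes \<epsilon> s :: real
    and F \<Theta> :: "int \<Rightarrow> int \<Rightarrow> real"
    and N N' :: "int \<Rightarrow> int \<Rightarrow> real^3"
  assumes "\<epsilon> \<in> {1, -1}"
    and "s \<in> {1, -1}"
    and "discrete_moutard F N"
    and "discrete_moutard F \<Theta>"
    and "\<forall>m1 m2. \<Theta> m1 m2 \<noteq> 0"
    and "moutard_transform s \<Theta> N N'"
  shows "((\<forall>m1 m2. \<Theta> (m1 + 1) (m2 + 1) + \<Theta> m1 m2 \<noteq> 0) \<longrightarrow>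
            ((\<forall>m1 m2. diagonal_product \<epsilon> N m1 m2 = diagonal_product \<epsilon> N' m1 m2)
              \<longleftrightarrow> (\<exists>U V k. separated_system \<epsilon> s N N' U V k))) \<and>
         ((\<exists>U V k. separated_system \<epsilon> s N N' U V k) \<longrightarrow>
            (\<forall>m1 m2. diagonal_product \<epsilon> N m1 m2 = diagonal_product \<epsilon> N' m1 m2))"
proof -
  define A where "A m1 m2 = eps_dot \<epsilon> (N' (m1 + 1) m2 - s *\<^sub>R N m1 m2) (N' m1 m2 - s *\<^sub>R N (m1 + 1) m2)" for m1 m2
  define B where "B m1 m2 = eps_dot \<epsilon> (N' m1 (m2 + 1) + s *\<^sub>R N m1 m2) (N' m1 m2 + s *\<^sub>R N m1 (m2 + 1))" for m1 m2
  have s: "s\<^sup>2 = 1" using assms(2) by auto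
  have N: "N (m1 + 1) (m2 + 1) + N m1 m2 = F m1 m2 *\<^sub>R (N (m1 + 1) m2 + N m1 (m2 + 1))"
    and \<Theta>: "\<Theta> (m1 + 1) (m2 + 1) + \<Theta> m1 m2 = F m1 m2 * (\<Theta> (m1 + 1) m2 + \<Theta> m1 (m2 + 1))" for m1 m2
    using assms(3,4) by (simp_all add: discrete_moutard_def)
  have T1: "N' (m1 + 1) m2 - s *\<^sub>R N m1 m2
          = (\<Theta> m1 m2 / \<Theta> (m1 + 1) m2) *\<^sub>R (N' m1 m2 - s *\<^sub>R N (m1 + 1) m2)"
    and T2: "N' m1 (m2 + 1) + s *\<^sub>R N m1 m2
          = (\<Theta> m1 m2 / \<Theta> m1 (m2 + 1)) *\<^sub>R (N' m1 m2 + s *\<^sub>R N m1 (m2 + 1))" for m1 m2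
    using assms(6) unfolding moutard_transform_def by blast+
  have sum: "A m1 m2 + A m1 (m2 + 1) + B m1 m2 + B (m1 + 1) m2
      = diagonal_product \<epsilon> N m1 m2 + diagonal_product \<epsilon> N' m1 m2" for m1 m2
    unfolding A_def B_def diagonal_product_def by (rule eps_dot_sum_around_square[OF s])
  \<comment> \<open>\<open>T1\<close> enters twice: on the edge at \<open>m2\<close> and on the
    opposite edge at \<open>m2 + 1\<close>.\<close>
  have A_incr: "(A m1 (m2 + 1) - A m1 m2) * (\<Theta> (m1 + 1) (m2 + 1) + \<Theta> m1 m2)
      = (diagonal_product \<epsilon> N' m1 m2 - diagonal_product \<epsilon> N m1 m2) * (\<Theta> m1 m2 - F m1 m2 * \<Theta> m1 (m2 + 1))"
    for m1 m2
    unfolding A_def diagonal_product_def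
    using assms(5) by (intro moutard_square_increment[OF s _ _ _ N \<Theta> T1 T2 T1]) auto
  have B_incr: "(B (m1 + 1) m2 - B m1 m2) * (\<Theta> (m1 + 1) (m2 + 1) + \<Theta> m1 m2)
      = (diagonal_product \<epsilon> N' m1 m2 - diagonal_product \<epsilon> N m1 m2) * (\<Theta> m1 m2 - F m1 m2 * \<Theta> (m1 + 1) m2)"
    for m1 m2
    \<comment> \<open>Exchanging the two directions amounts to replacing \<open>s\<close> by \<open>- s\<close>.\<close>
    using moutard_square_increment[of "- s" "\<Theta> m1 (m2 + 1)" "\<Theta> (m1 + 1) m2" "\<Theta> (m1 + 1) (m2 + 1)"
        "N (m1 + 1) (m2 + 1)" "N m1 m2" "F m1 m2" "N m1 (m2 + 1)" "N (m1 + 1) m2" "\<Theta> m1 m2"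
        "N' m1 (m2 + 1)" "N' m1 m2" "N' (m1 + 1) m2" "N' (m1 + 1) (m2 + 1)" \<epsilon>]
      s assms(5) N[of m1 m2] \<Theta>[of m1 m2] T1[of m1 m2] T2[of m1 m2] T2[of "m1 + 1" m2]
    unfolding B_def diagonal_product_def by (simp add: add.commute)
  have equal: "\<forall>m1 m2. diagonal_product \<epsilon> N m1 m2 = diagonal_product \<epsilon> N' m1 m2"
    if sys: "\<exists>U V k. separated_system \<epsilon> s N N' U V k"
  proof (intro allI)
    fix m1 m2
    from sys obtain U V k where "diagonal_product \<epsilon> N m1 m2 = U m1 + V m2"
      and "\<And>m1 m2. A m1 m2 = U m1 - s * k" and "\<And>m1 m2. B m1 m2 = V m2 + s * k"
      unfolding separated_system_def A_def B_def by blast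
    \<comment> \<open>The terms \<open>s * k\<close> cancel in the sum around the square.\<close>
    then show "diagonal_product \<epsilon> N m1 m2 = diagonal_product \<epsilon> N' m1 m2"
      using sum[of m1 m2] by simp
  qed
  have system: "\<exists>U V k. separated_system \<epsilon> s N N' U V k"
    if nondeg: "\<forall>m1 m2. \<Theta> (m1 + 1) (m2 + 1) + \<Theta> m1 m2 \<noteq> 0"
      and eq: "\<forall>m1 m2. diagonal_product \<epsilon> N m1 m2 = diagonal_product \<epsilon> N' m1 m2"
  proof -
    \<comment> \<open>Cancelling \<open>\<Theta> (m1 + 1) (m2 + 1) + \<Theta> m1 m2\<close> requires
      \<open>nondeg\<close>; where this factor vanishes, the increment identities say nothing about
      the increments.\<close>
    have A_step: "A m1 (m2 + 1) = A m1 m2" and B_step: "B (m1 + 1) m2 = B m1 m2" for m1 m2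
      using A_incr[of m1 m2] B_incr[of m1 m2] nondeg eq by auto
    have "diagonal_product \<epsilon> N m1 m2 = A m1 m2 + B m1 m2" for m1 m2
      using sum[of m1 m2] eq A_step B_step by simp
    moreover have A_const: "A m1 m2 = A m1 0" for m1 m2
      using int_shift_invariant_imp_const[of "A m1"] A_step by blast
    moreover have B_const: "B m1 m2 = B 0 m2" for m1 m2
      using int_shift_invariant_imp_const[of "\<lambda>m. B m m2"] B_step by blast
    \<comment> \<open>Taking \<open>k = 0\<close> is a normalisation: adding \<open>s * c\<close> to
      \<open>U\<close>, \<open>- s * c\<close> to \<open>V\<close> and \<open>c\<close> to
      \<open>k\<close> preserves the system.\<close>
    ultimately have "separated_system \<epsilon> s N N' (\<lambda>m1. A m1 0) (\<lambda>m2. B 0 m2) 0"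
      unfolding separated_system_def A_def[symmetric] B_def[symmetric]
      by (metis add.right_neutral diff_zero mult_zero_right)
    then show ?thesis by blast
  qed
  show ?thesis using equal system by blast
qed

end
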